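(* Let $A\in\mathbb{R}^{n\times n}$ be a normal matrix, regarded as a linear operator on Euclidean space $\mathbb{R}^n$, and let $\rho(A):=\max\{|\lambda| : \lambda \text{ is an eigenvalue of } A\}$ be its spectral radius. (i) Suppose that one of the following holds: (a) $\rho(A)<1$; (b) $\rho(A)=1$, where $\lambda=1$ is the only eigenvalue of $A$ on the unit circle and it is semisimple. Then $A$ is a BAM. (ii) The following are equivalent: (a) $\lim_{k\to\infty}A^k$ exists; (b) $\lim_{k\to\infty}A^k=\mathrm{P}_{\operatorname{Fix}A}$; (c) $A$ is a BAM.
   Context: Eigenvalues are complex eigenvalues of $A$; an eigenvalue is semisimple if its algebraic and geometric multiplicities coincide. $\mathrm{P}_C$ denotes the metric projection onto a nonempty closed convex set $C$, and $\operatorname{Fix}G=\{x: Gx=x\}$. Definition (BAM). Let $\mathcal{H}$ be a real Hilbert space, $G:\mathcal{H}\to\mathcal{H}$ and $\gamma\in[0,1[$. $G$ is a best approximation mapping with constant $\gamma$ ($\gamma$-BAM) if (1) $\operatorname{Fix}G$ is a nonempty closed convex subset of $\mathcal{H}$; (2) $\mathrm{P}_{\operatorname{Fix}G}G=\mathrm{P}_{\operatorname{Fix}G}$; (3) $\|Gx-\mathrm{P}_{\operatorname{Fix}G}x\|\le\gamma\|x-\mathrm{P}_{\operatorname{Fix}G}x\|$ for all $x\in\mathcal{H}$. $G$ is a BAM if it is a $\gamma$-BAM for some $\gamma\in[0,1[$. *)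

theory Defs
  imports "HOL-Analysis.Analysis" "HOL-Computational_Algebra.Polynomial"
begin

section \<open>Best approximation mappings\<close>

text \<open>The library's \<^const>\<open>closest_point\<close> is confined to Heine-Borel (hence finite-dimensional)
  spaces; this is the same definition without that restriction.  In a Hilbert space, for a nonempty
  closed convex \<open>C\<close>, the minimiser exists and is unique, so the choice is immaterial.\<close>

definition metric_proj :: "'a::{real_inner,complete_space} set \<Rightarrow> 'a \<Rightarrow> 'a" where
  "metric_proj C x = (SOME p. p \<in> C \<and> (\<forall>y\<in>C. dist x p \<le> dist x y))"

lemma metric_proj_eq_closest_point:
  fixes C :: "'a::{real_inner,heine_borel} set"
  shows "metric_proj C = closest_point C"
  by (simp add: fun_eq_iff metric_proj_def closest_point_def)

definition Fix :: "('a \<Rightarrow> 'a) \<Rightarrow> 'a set" where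
  "Fix G = {x. G x = x}"

definition is_BAM_with :: "real \<Rightarrow> ('a::{real_inner,complete_space} \<Rightarrow> 'a) \<Rightarrow> bool" where
  "is_BAM_with \<gamma> G \<longleftrightarrow>
     0 \<le> \<gamma> \<and> \<gamma> < 1 \<and>
     Fix G \<noteq> {} \<and> closed (Fix G) \<and> convex (Fix G) \<and>
     metric_proj (Fix G) \<circ> G = metric_proj (Fix G) \<and>
     (\<forall>x. norm (G x - metric_proj (Fix G) x) \<le> \<gamma> * norm (x - metric_proj (Fix G) x))"

definition is_BAM :: "('a::{real_inner,complete_space} \<Rightarrow> 'a) \<Rightarrow> bool" where
  "is_BAM G \<longleftrightarrow> (\<exists>\<gamma>. is_BAM_with \<gamma> G)"

section \<open>Real square matrices and their complex eigenvalues\<close>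

definition normal_matrix :: "real^'n^'n \<Rightarrow> bool" where
  "normal_matrix A \<longleftrightarrow> A ** transpose A = transpose A ** A"

text \<open>The operation \<open>^\<close> is not used because multiplication on \<^typ>\<open>'a^'n\<close> is componentwise.\<close>

primrec matrix_pow :: "'a::semiring_1^'n^'n \<Rightarrow> nat \<Rightarrow> 'a^'n^'n" where
  "matrix_pow A 0 = mat 1"
| "matrix_pow A (Suc k) = A ** matrix_pow A k"

abbreviation complexify :: "real^'n^'n \<Rightarrow> complex^'n^'n" where
  "complexify \<equiv> map_matrix complex_of_real"

definition ceigenspace :: "real^'n^'n \<Rightarrow> complex \<Rightarrow> (complex^'n) set" where
  "ceigenspace A \<mu> = {v. complexify A *v v = \<mu> *s v}"

definition ceigenvalue :: "real^'n^'n \<Rightarrow> complex \<Rightarrow> bool" where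
  "ceigenvalue A \<mu> \<longleftrightarrow> (\<exists>v. v \<noteq> 0 \<and> complexify A *v v = \<mu> *s v)"

definition characteristic_poly :: "real^'n^'n \<Rightarrow> complex poly" where
  "characteristic_poly A = det (mat [:0, 1:] - map_matrix (\<lambda>c. [:c:]) (complexify A))"

definition algebraic_mult :: "real^'n^'n \<Rightarrow> complex \<Rightarrow> nat" where
  "algebraic_mult A \<mu> = order \<mu> (characteristic_poly A)"

text \<open>\<^const>\<open>vec.dim\<close> is the dimension over the field of entries, here the complex numbers;
  \<^const>\<open>dim\<close> would be the real dimension.\<close>

definition geometric_mult :: "real^'n^'n \<Rightarrow> complex \<Rightarrow> nat" where
  "geometric_mult A \<mu> = vec.dim (ceigenspace A \<mu>)"

definition semisimple_eigenvalue :: "real^'n^'n \<Rightarrow> complex \<Rightarrow> bool" where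
  "semisimple_eigenvalue A \<mu> \<longleftrightarrow> ceigenvalue A \<mu> \<and> algebraic_mult A \<mu> = geometric_mult A \<mu>"

definition matrix_spectral_radius :: "real^'n^'n \<Rightarrow> real" where
  "matrix_spectral_radius A = Max {cmod \<mu> | \<mu>. ceigenvalue A \<mu>}"

end

(*
  On the orthogonal complement V of Fix A, which a normal A and its transpose leave invariant, the
  maximum of |A x|^2 over unit vectors is the largest eigenvalue m of the symmetric operator A^T A.
  If m < 1, then A is a strict contraction on V, hence a BAM.  If m >= 1, let E be the corresponding
  eigenspace in V, which contains no nonzero fixed point of A; as A commutes with A^T, it is
  invariant under both and A is sqrt m times an isometry on E.  Then A^k (A x - x) does not tend
  to 0 for x in E nonzero, so the powers of A diverge; and diagonalising A + A^T and then
  (A - a)^T (A - a) inside E gives a plane (or a line) on which A is a rotation times sqrt m, i.e. a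
  complex eigenvalue of modulus sqrt m >= 1 that is not 1.  Conversely, a BAM satisfies
  |A^k x - P x| <= gamma^k |x - P x|.
*)
theory Submission
  imports Defs
begin

text \<open>This simp rule turns \<open>transpose A *v x\<close> into \<open>x v* A\<close>; below,
  the transpose has to stay visible as the adjoint operator.\<close>

declare transpose_matrix_vector [simp del]

section \<open>Eigenvectors of symmetric operators by maximisation\<close>

text \<open>Near 0 the linear term dominates and changes sign. This serves as the first-order
  condition at a maximum.\<close>

lemma nonneg_quadratic_imp_linear_coeff_zero:
  fixes p q :: real
  assumes "\<And>t. 0 \<le> t * p + t\<^sup>2 * q"
  shows "p = 0"
proof (rule ccontr)
  assume "p \<noteq> 0"
  \<comment> \<open>Since c exceeds both 0 and q, the quadratic is negative at t = - p / c.\<close>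
  define c where "c = \<bar>q\<bar> + 1"
  have c: "c > 0" "q < c" by (auto simp: c_def)
  have "0 \<le> (- p / c) * p + (- p / c)\<^sup>2 * q" by (rule assms)
  also have "\<dots> = - (p\<^sup>2 / c) * (1 - q / c)"
    using c by (simp add: field_simps power2_eq_square)
  also have "\<dots> < 0"
    using c \<open>p \<noteq> 0\<close> by (simp add: mult_pos_pos)
  finally show False by simp
qed

text \<open>By compactness \<open>y \<bullet> f y\<close> attains its maximum m on the unit sphere
  of S, and vanishing of the first variation makes the maximiser an eigenvector.\<close>

lemma symmetric_max_eigenvector:
  fixes f :: "'a::euclidean_space \<Rightarrow> 'a"
  assumes lin: "linear f" and sym: "\<And>x y. f x \<bullet> y = x \<bullet> f y"
    and S: "subspace S" "\<And>x. x \<in> S \<Longrightarrow> f x \<in> S" "S \<noteq> {0}"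
  obtains m x where "x \<in> S" "x \<noteq> 0" "f x = m *\<^sub>R x" "\<And>y. y \<in> S \<Longrightarrow> y \<bullet> f y \<le> m * (norm y)\<^sup>2"
proof -
  define K where "K = S \<inter> sphere 0 1"
  have "compact K"
    unfolding K_def by (intro closed_Int_compact closed_subspace S compact_sphere)
  obtain z where z: "z \<in> S" "z \<noteq> 0" using S subspace_0 by blast
  then have "z /\<^sub>R norm z \<in> K" by (simp add: K_def S subspace_scale)
  moreover have "continuous_on K (\<lambda>y. y \<bullet> f y)"
    by (intro continuous_intros linear_continuous_on) (use lin linear_conv_bounded_linear in blast)
  ultimately obtain x where x: "x \<in> K" and max: "\<And>y. y \<in> K \<Longrightarrow> y \<bullet> f y \<le> x \<bullet> f x"
    using continuous_attains_sup[OF \<open>compact K\<close>] by blast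
  define m where "m = x \<bullet> f x"
  have xS: "x \<in> S" and nx: "x \<bullet> x = 1" using x by (auto simp: K_def norm_eq_1)
  have bound: "y \<bullet> f y \<le> m * (norm y)\<^sup>2" if "y \<in> S" for y
  proof (cases "y = 0")
    case True
    then show ?thesis by simp
  next
    case False
    then have "y /\<^sub>R norm y \<in> K" using that by (simp add: K_def S subspace_scale)
    from max[OF this] have "(y \<bullet> f y) / (norm y)\<^sup>2 \<le> m"
      by (simp add: m_def linear_scale[OF lin] power2_eq_square divide_simps)
    then show ?thesis using False by (simp add: divide_simps)
  qed
  have "(m *\<^sub>R x - f x) \<bullet> y = 0" if y: "y \<in> S" for y
  proof -
    \<comment> \<open>This is \<open>bound\<close> at \<open>x + t *\<^sub>R y\<close>: the constant
      term cancels because m is the value at the unit vector x, and symmetry merges the cross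
      terms.\<close>
    have "0 \<le> t * (2 * ((m *\<^sub>R x - f x) \<bullet> y)) + t\<^sup>2 * (m * (y \<bullet> y) - y \<bullet> f y)" for t
    proof -
      have "x + t *\<^sub>R y \<in> S" using xS y S by (simp add: subspace_add subspace_scale)
      from bound[OF this] have
        "(x + t *\<^sub>R y) \<bullet> f (x + t *\<^sub>R y) \<le> m * ((x + t *\<^sub>R y) \<bullet> (x + t *\<^sub>R y))"
        by (simp add: power2_norm_eq_inner)
      then show ?thesis
        using sym[of x y] nx
        by (simp add: linear_add[OF lin] linear_scale[OF lin] inner_simps
            inner_commute[of y x] inner_commute[of y "f x"] m_def power2_eq_square algebra_simps)
    qed
    from nonneg_quadratic_imp_linear_coeff_zero[OF this] show ?thesis by simp
  qed
  \<comment> \<open>The residual lies in S and is orthogonal to S, hence is zero.\<close>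
  moreover have "m *\<^sub>R x - f x \<in> S" using xS S by (simp add: subspace_diff subspace_scale)
  ultimately have "f x = m *\<^sub>R x" by (metis eq_iff_diff_eq_0 inner_eq_zero_iff)
  with xS nx bound show thesis by (intro that[of x m]) auto
qed

lemma subspace_eigenspace:
  assumes "linear f" "subspace S"
  shows "subspace {x \<in> S. f x = c *\<^sub>R x}"
  using assms
  by (auto simp: subspace_def linear_add linear_scale linear_0 scaleR_add_right mult.commute)

section \<open>Normal matrices: contraction or expansion off the fixed points\<close>

lemma inner_matrix_vector_transpose:
  fixes A :: "real^'n^'m"
  shows "(A *v x) \<bullet> y = x \<bullet> (transpose A *v y)"
  by (metis dot_lmul_matrix inner_commute transpose_matrix_vector)

lemma inner_transpose_matrix_vector:
  fixes A :: "real^'n^'m"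
  shows "(transpose A *v x) \<bullet> y = x \<bullet> (A *v y)"
  using inner_matrix_vector_transpose[of "transpose A"] by simp

lemma normal_matrix_commute:
  assumes "normal_matrix A"
  shows "A *v (transpose A *v x) = transpose A *v (A *v x)"
  using assms by (simp add: normal_matrix_def matrix_vector_mul_assoc)

text \<open>Normality makes the defect d = A^T x - x a fixed point of A, so |d|^2 = (A d - d)
  \<bullet> x = 0. It follows that A preserves the orthogonal complement of its fixed
  points.\<close>

lemma normal_matrix_fixed_transpose:
  assumes "normal_matrix A" "A *v x = x"
  shows "transpose A *v x = x"
proof -
  let ?d = "transpose A *v x - x"
  have "?d \<bullet> ?d = (A *v ?d - ?d) \<bullet> x"
    by (simp add: inner_matrix_vector_transpose inner_diff_left inner_diff_right)
  also have "A *v ?d - ?d = 0"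
    using assms normal_matrix_commute[OF assms(1), of x]
    by (simp add: matrix_vector_mult_diff_distrib)
  finally show ?thesis by simp
qed

lemma subspace_Fix_matrix: "subspace (Fix ((*v) (A::real^'n^'n)))"
  by (auto simp: subspace_def Fix_def matrix_vector_right_distrib matrix_vector_mult_scaleR)

text \<open>The premise in \<open>contraction\<close> says that x is orthogonal to
  \<open>Fix A\<close>. In \<open>expansion\<close>, A^T A = m on E, so there A multiplies norms by
  sqrt m \<ge> 1.\<close>

lemma normal_matrix_contraction_cases:
  fixes A :: "real^'n^'n"
  assumes A: "normal_matrix A"
  obtains
    (contraction) \<gamma> where "0 \<le> \<gamma>" "\<gamma> < 1"
      "\<And>x. \<lbrakk>\<And>z. A *v z = z \<Longrightarrow> z \<bullet> x = 0\<rbrakk> \<Longrightarrow> norm (A *v x) \<le> \<gamma> * norm x"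
  | (expansion) E m where "subspace E" "E \<noteq> {0}" "1 \<le> m"
      "\<And>x. x \<in> E \<Longrightarrow> A *v x \<in> E" "\<And>x. x \<in> E \<Longrightarrow> transpose A *v x \<in> E"
      "\<And>x. x \<in> E \<Longrightarrow> transpose A *v (A *v x) = m *\<^sub>R x"
      "\<And>x. \<lbrakk>x \<in> E; A *v x = x\<rbrakk> \<Longrightarrow> x = 0"
proof -
  define V where "V = {x. \<forall>z. A *v z = z \<longrightarrow> z \<bullet> x = 0}"
  have V: "subspace V"
    by (auto simp: V_def subspace_def inner_add_right)
  have VA: "A *v x \<in> V" "transpose A *v x \<in> V" if "x \<in> V" for x
    using that normal_matrix_fixed_transpose[OF A]
    by (simp_all add: V_def flip: inner_matrix_vector_transpose inner_transpose_matrix_vector)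
  show thesis
  proof (cases "V = {0}")
    case True
    then have "x = 0" if "\<And>z. A *v z = z \<Longrightarrow> z \<bullet> x = 0" for x
      using that by (auto simp: V_def)
    \<comment> \<open>Only x = 0 is orthogonal to all fixed points, so the constant 0
      serves.\<close>
    then show thesis using contraction[of 0] by fastforce
  next
    case False
    let ?f = "\<lambda>x. transpose A *v (A *v x)"
    have f: "x \<bullet> ?f x = (norm (A *v x))\<^sup>2" for x
      by (simp add: inner_matrix_vector_transpose[symmetric] power2_norm_eq_inner)
    have linf: "linear ?f"
      by (simp add: matrix_vector_mul_assoc)
    obtain m x where x: "x \<in> V" "x \<noteq> 0" "?f x = m *\<^sub>R x"
      and bound: "\<And>y. y \<in> V \<Longrightarrow> y \<bullet> ?f y \<le> m * (norm y)\<^sup>2"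
    proof (rule symmetric_max_eigenvector[OF linf _ V _ False])
      show "?f x \<bullet> y = x \<bullet> ?f y" for x y
        by (simp add: inner_matrix_vector_transpose inner_transpose_matrix_vector)
    qed (use VA in auto)
    have "m * (norm x)\<^sup>2 = (norm (A *v x))\<^sup>2"
      using f[of x] x by (simp add: power2_norm_eq_inner)
    then have "0 \<le> m * (norm x)\<^sup>2" by simp
    then have m: "0 \<le> m" using x by (simp add: zero_le_mult_iff)
    show thesis
    proof (cases "m < 1")
      case True
      show thesis
      proof (rule contraction[of "sqrt m"])
        fix y assume "\<And>z. A *v z = z \<Longrightarrow> z \<bullet> y = 0"
        then have "(norm (A *v y))\<^sup>2 \<le> m * (norm y)\<^sup>2"
          using bound[of y] f[of y] by (simp add: V_def)
        then show "norm (A *v y) \<le> sqrt m * norm y"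
          using real_le_rsqrt by (fastforce simp: real_sqrt_mult)
      qed (use True m in auto)
    next
      case False
      define E where "E = {x \<in> V. ?f x = m *\<^sub>R x}"
      show thesis
      proof (rule expansion[of E m])
        show "subspace E"
          unfolding E_def by (rule subspace_eigenspace[OF linf V])
        show "E \<noteq> {0}" using x by (auto simp: E_def)
        show "1 \<le> m" using False by simp
        show "A *v y \<in> E" "transpose A *v y \<in> E" if "y \<in> E" for y
        proof -
          \<comment> \<open>Both A and A^T commute with A^T A and therefore preserve its
            eigenspaces.\<close>
          have "?f (A *v y) = A *v ?f y" "?f (transpose A *v y) = transpose A *v ?f y"
            by (simp_all add: normal_matrix_commute[OF A])
          then show "A *v y \<in> E" "transpose A *v y \<in> E"
            using that VA by (simp_all add: E_def matrix_vector_mult_scaleR)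
        qed
        show "?f y = m *\<^sub>R y" if "y \<in> E" for y
          using that by (simp add: E_def)
        \<comment> \<open>A fixed point in V is orthogonal to itself.\<close>
        show "y = 0" if "y \<in> E" "A *v y = y" for y
          using that by (auto simp: E_def V_def)
      qed
    qed
  qed
qed

section \<open>Invariant planes and complex eigenvalues\<close>

text \<open>On an eigenspace of A + A^T, A is a scalar a plus a skew map K. An eigenvector x of K^T
  K with nonzero eigenvalue spans, together with K x, a plane on which A acts as multiplication by a
  complex number.\<close>

lemma normal_matrix_invariant_rotation:
  fixes A :: "real^'n^'n"
  assumes A: "normal_matrix A" and E: "subspace E" "E \<noteq> {0}"
    and inv: "\<And>x. x \<in> E \<Longrightarrow> A *v x \<in> E" "\<And>x. x \<in> E \<Longrightarrow> transpose A *v x \<in> E"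
  obtains a b x y where "x \<in> E" "x \<noteq> 0" "y \<in> E"
    "A *v x = a *\<^sub>R x - b *\<^sub>R y" "A *v y = b *\<^sub>R x + a *\<^sub>R y"
proof -
  let ?T = "transpose A"
  let ?g = "\<lambda>x. A *v x + ?T *v x"
  have ling: "linear ?g"
    by (intro linear_compose_add matrix_vector_mul_linear)
  obtain c u where u: "u \<in> E" "u \<noteq> 0" "?g u = c *\<^sub>R u"
  proof (rule symmetric_max_eigenvector[OF ling _ E(1) _ E(2)])
    show "?g x \<bullet> y = x \<bullet> ?g y" for x y
      by (simp add: inner_add_left inner_add_right inner_matrix_vector_transpose
          inner_transpose_matrix_vector)
    show "?g x \<in> E" if "x \<in> E" for x
      using that E inv by (simp add: subspace_add)
  qed
  \<comment> \<open>On D, A + A^T = 2 a, which is what makes A - a skew there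
    (\<open>LK\<close>).\<close>
  define a where "a = c / 2"
  define D where "D = {x \<in> E. ?g x = c *\<^sub>R x}"
  have D: "subspace D" "D \<noteq> {0}"
    using subspace_eigenspace[OF ling E(1), of c] u by (auto simp: D_def)
  have DA: "A *v x \<in> D" "?T *v x \<in> D" if "x \<in> D" for x
  proof -
    have x: "x \<in> E" "?g x = c *\<^sub>R x" using that by (auto simp: D_def)
    have "?g (A *v x) = A *v ?g x" "?g (?T *v x) = ?T *v ?g x"
      by (simp_all add: matrix_vector_right_distrib normal_matrix_commute[OF A])
    then show "A *v x \<in> D" "?T *v x \<in> D"
      using x inv by (auto simp: D_def matrix_vector_mult_scaleR)
  qed
  let ?K = "\<lambda>x. A *v x - a *\<^sub>R x"
  let ?L = "\<lambda>x. ?T *v x - a *\<^sub>R x"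
  have adj: "?K x \<bullet> y = x \<bullet> ?L y" for x y
    by (simp add: inner_diff_left inner_diff_right inner_matrix_vector_transpose)
  have LK: "?L x = - ?K x" if "x \<in> D" for x
  proof -
    have "A *v x + ?T *v x = a *\<^sub>R x + a *\<^sub>R x"
      using that by (simp add: D_def a_def flip: scaleR_add_left)
    then show ?thesis by (simp add: algebra_simps)
  qed
  have linh: "linear (\<lambda>x. ?L (?K x))"
    by (intro linearI)
      (simp_all add: matrix_vector_right_distrib matrix_vector_mult_diff_distrib
        matrix_vector_mult_scaleR algebra_simps)
  obtain m x where x: "x \<in> D" "x \<noteq> 0" "?L (?K x) = m *\<^sub>R x"
  proof (rule symmetric_max_eigenvector[OF linh _ D(1) _ D(2)])
    show "?L (?K x) \<bullet> y = x \<bullet> ?L (?K y)" for x y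
      using adj[of x "?K y"] adj[of y "?K x"] by (simp only: inner_commute)
    show "?L (?K x) \<in> D" if "x \<in> D" for x
      using that D DA by (simp add: subspace_diff subspace_scale)
  qed
  have KD: "?K x \<in> D" using x D DA by (simp add: subspace_diff subspace_scale)
  have DE: "D \<subseteq> E" by (auto simp: D_def)
  have sq: "?K x \<bullet> ?K x = m * (x \<bullet> x)" using adj[of x "?K x"] x(3) by simp
  then have "0 \<le> m * (x \<bullet> x)" by (metis inner_ge_zero)
  then have m: "0 \<le> m"
    using x(2) by (auto simp: zero_le_mult_iff simp flip: power2_norm_eq_inner)
  show thesis
  proof (cases "m = 0")
    case True
    with sq have "?K x = 0" by (metis inner_eq_zero_iff mult_zero_left)
    show thesis
      \<comment> \<open>If K x = 0, then x is a real eigenvector and the plane degenerates to a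
        line, with y = 0 and b = 0.\<close>
      by (rule that[of x 0 a 0]) (use x DE E \<open>?K x = 0\<close> in \<open>auto simp: subspace_0\<close>)
  next
    case False
    define b where "b = sqrt m"
    have b: "b \<noteq> 0" "b * b = m" using False m by (auto simp: b_def)
    \<comment> \<open>Scaled so that K x = - b y; then K (K x) = - m x and b^2 = m give K y = b
      x.\<close>
    define y where "y = (- 1 / b) *\<^sub>R ?K x"
    have "?K (?K x) = - (m *\<^sub>R x)" using LK[OF KD] x(3) by simp
    moreover have "?K y = (- 1 / b) *\<^sub>R ?K (?K x)"
      unfolding y_def by (simp add: matrix_vector_mult_scaleR algebra_simps)
    ultimately have "?K y = (m / b) *\<^sub>R x" by simp
    also have "m / b = b" using b by (simp add: field_simps)
    finally have Ky: "?K y = b *\<^sub>R x" .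
    have "b *\<^sub>R y = - ?K x" using b by (simp add: y_def)
    then have "A *v x = a *\<^sub>R x - b *\<^sub>R y" by simp
    moreover have "A *v y = b *\<^sub>R x + a *\<^sub>R y" using Ky by (simp add: algebra_simps)
    moreover have "y \<in> D" unfolding y_def by (intro subspace_scale D KD)
    ultimately show thesis using x DE by (intro that[of x y a b]) auto
  qed
qed

text \<open>The eigenvector is x + i y, since (a + i b) (x + i y) = (a x - b y) + i (b x + a
  y).\<close>

lemma ceigenvalue_of_rotation:
  fixes A :: "real^'n^'n"
  assumes "x \<noteq> 0" "A *v x = a *\<^sub>R x - b *\<^sub>R y" "A *v y = b *\<^sub>R x + a *\<^sub>R y"
  shows "ceigenvalue A (Complex a b)"
proof -
  define v :: "complex^'n" where "v = (\<chi> i. Complex (x $ i) (y $ i))"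
  have "v \<noteq> 0" using assms(1) by (auto simp: v_def vec_eq_iff complex_eq_iff)
  moreover have "complexify A *v v = Complex a b *s v"
  proof (rule vec_eq_iff[THEN iffD2, rule_format])
    fix i
    have "(complexify A *v v) $ i = Complex ((A *v x) $ i) ((A *v y) $ i)"
      by (simp add: v_def matrix_vector_mult_def map_matrix_def complex_eq_iff)
    also have "\<dots> = (Complex a b *s v) $ i"
      by (simp add: assms v_def complex_eq_iff)
    finally show "(complexify A *v v) $ i = (Complex a b *s v) $ i" .
  qed
  ultimately show ?thesis by (auto simp: ceigenvalue_def)
qed

section \<open>Characteristic polynomial and spectral radius\<close>

text \<open>Evaluation at z is a ring homomorphism, and the determinant is a polynomial in the
  entries.\<close>

lemma poly_det: "poly (det M) z = det (\<chi> i j. poly (M $ i $ j) z)"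
  by (simp add: det_def poly_sum poly_prod)

lemma norm_vector_scalar_mult: "norm (c *s v) = cmod c * norm v"
  by (simp add: norm_vec_def norm_mult L2_set_right_distrib)

lemma poly_characteristic_poly:
  "poly (characteristic_poly A) z = det (mat z - complexify A)"
proof -
  have "(\<chi> i j. poly ((mat [:0, 1:] - map_matrix (\<lambda>c. [:c:]) (complexify A)) $ i $ j) z)
      = mat z - complexify A"
    by (simp add: vec_eq_iff mat_def map_matrix_def)
  then show ?thesis by (simp add: characteristic_poly_def poly_det)
qed

lemma ceigenvalue_iff_root: "ceigenvalue A z \<longleftrightarrow> poly (characteristic_poly A) z = 0"
proof -
  have "(mat z - complexify A) *v v = z *s v - complexify A *v v" for v
  proof -
    have "mat z *v v = z *s v"
      by (simp add: vec_eq_iff matrix_vector_mult_def mat_def if_distrib[of "\<lambda>c. c * _"] cong: if_cong)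
    then show ?thesis by (simp add: matrix_vector_mult_diff_rdistrib)
  qed
  moreover have "det (mat z - complexify A) = 0 \<longleftrightarrow> (\<exists>v. v \<noteq> 0 \<and> (mat z - complexify A) *v v = 0)"
    by (metis invertible_det_nz invertible_left_inverse matrix_left_invertible_ker)
  ultimately show ?thesis
    by (simp add: ceigenvalue_def poly_characteristic_poly) metis
qed

text \<open>The eigenvalues are the roots of the characteristic polynomial, which is nonzero because
  a number beyond the operator bound B is not a root. Finiteness gives \<open>Max\<close> in the
  spectral radius its meaning.\<close>

lemma finite_ceigenvalues: "finite {z. ceigenvalue A z}"
proof -
  have "linear ((*v) (complexify A))"
    by (rule matrix_vector_mul_linear)
  then obtain B where B: "\<And>v. norm (complexify A *v v) \<le> B * norm v"
    using linear_bounded by blast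
  have "cmod z \<le> B" if "ceigenvalue A z" for z
  proof -
    obtain v where "v \<noteq> 0" "complexify A *v v = z *s v"
      using \<open>ceigenvalue A z\<close> by (auto simp: ceigenvalue_def)
    then show ?thesis using B[of v] by (simp add: norm_vector_scalar_mult)
  qed
  then have "\<not> ceigenvalue A (of_real (\<bar>B\<bar> + 1))" by force
  then have "characteristic_poly A \<noteq> 0" by (auto simp: ceigenvalue_iff_root)
  then show ?thesis by (simp add: ceigenvalue_iff_root poly_roots_finite)
qed

lemma ceigenvalue_le_spectral_radius:
  assumes "ceigenvalue A z"
  shows "cmod z \<le> matrix_spectral_radius A"
  unfolding matrix_spectral_radius_def
  using assms finite_ceigenvalues[of A] by (intro Max_ge) (auto simp: setcompr_eq_image)

section \<open>Projection onto the fixed points and the BAM property\<close>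

text \<open>By Pythagoras, |x - z|^2 = |x - p|^2 + |p - z|^2 for every z in S.\<close>

lemma metric_proj_subspace:
  fixes S :: "'a::euclidean_space set"
  assumes "subspace S" "p \<in> S" and orth: "\<And>z. z \<in> S \<Longrightarrow> z \<bullet> (x - p) = 0"
  shows "metric_proj S x = p"
proof -
  have "dist x p \<le> dist x z" if "z \<in> S" for z
  proof -
    have "(p - z) \<bullet> (x - p) = 0" using assms that by (simp add: subspace_diff)
    then have "(norm (x - z))\<^sup>2 = (norm (x - p))\<^sup>2 + (norm (p - z))\<^sup>2"
      by (simp add: power2_norm_eq_inner inner_simps inner_commute)
    then show ?thesis by (simp add: dist_norm power2_le_imp_le)
  qed
  then have "p = closest_point S x"
    using assms by (intro closest_point_unique subspace_imp_convex closed_subspace) auto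
  then show ?thesis by (simp add: metric_proj_eq_closest_point)
qed

text \<open>Split x = p + w with p fixed and w orthogonal to \<open>Fix A\<close>. Then A x = p + A
  w with A w again orthogonal, so A x and x share the projection p and only w is contracted.\<close>

lemma normal_matrix_contraction_imp_BAM:
  fixes A :: "real^'n^'n"
  assumes A: "normal_matrix A" and \<gamma>: "0 \<le> \<gamma>" "\<gamma> < 1"
    and contr: "\<And>x. \<lbrakk>\<And>z. A *v z = z \<Longrightarrow> z \<bullet> x = 0\<rbrakk> \<Longrightarrow> norm (A *v x) \<le> \<gamma> * norm x"
  shows "is_BAM ((*v) A)"
proof -
  let ?F = "Fix ((*v) A)"
  note F = subspace_Fix_matrix[of A]
  have main: "metric_proj ?F (A *v x) = metric_proj ?F x \<and>
      norm (A *v x - metric_proj ?F x) \<le> \<gamma> * norm (x - metric_proj ?F x)" for x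
  proof -
    obtain p w where p: "p \<in> ?F" and w: "\<And>z. z \<in> ?F \<Longrightarrow> w \<bullet> z = 0" and x: "x = p + w"
      using orthogonal_subspace_decomp_exists[of ?F x] span_eq_iff[THEN iffD2, OF F]
      by (metis orthogonal_def)
    have Ap: "A *v p = p" using p by (simp add: Fix_def)
    have orth: "z \<bullet> (A *v w) = 0" if "z \<in> ?F" for z
      using w[OF that] that normal_matrix_fixed_transpose[OF A, of z]
      by (simp add: Fix_def inner_commute[of z "A *v w"] inner_matrix_vector_transpose)
    have "metric_proj ?F x = p"
      by (rule metric_proj_subspace[OF F p]) (use w x in \<open>simp add: inner_commute\<close>)
    moreover have "metric_proj ?F (A *v x) = p"
      by (rule metric_proj_subspace[OF F p])
        (use orth x Ap in \<open>simp add: matrix_vector_right_distrib\<close>)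
    moreover have "norm (A *v w) \<le> \<gamma> * norm w"
      by (rule contr) (use w in \<open>auto simp: Fix_def inner_commute\<close>)
    ultimately show ?thesis using x Ap by (simp add: matrix_vector_right_distrib)
  qed
  have "is_BAM_with \<gamma> ((*v) A)"
    unfolding is_BAM_with_def
    using \<gamma> main F subspace_0[OF F] closed_subspace[OF F] subspace_imp_convex[OF F]
    by (auto simp: fun_eq_iff)
  then show ?thesis by (auto simp: is_BAM_def)
qed

text \<open>In the expansion case the rotation inside E yields an eigenvalue of modulus at least 1
  other than 1, against \<open>spec\<close>.\<close>

lemma normal_matrix_spectrum_imp_BAM:
  fixes A :: "real^'n^'n"
  assumes A: "normal_matrix A"
    and spec: "\<And>z. ceigenvalue A z \<Longrightarrow> cmod z < 1 \<or> z = 1"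
  shows "is_BAM ((*v) A)"
  using A
proof (cases rule: normal_matrix_contraction_cases)
  case (contraction \<gamma>)
  then show ?thesis using normal_matrix_contraction_imp_BAM[OF A] by blast
next
  case (expansion E m)
  obtain a b x y where xy: "x \<in> E" "x \<noteq> 0" "y \<in> E"
    and Ax: "A *v x = a *\<^sub>R x - b *\<^sub>R y" and Ay: "A *v y = b *\<^sub>R x + a *\<^sub>R y"
    by (rule normal_matrix_invariant_rotation[OF A expansion(1,2,4,5)])
  have nrm: "(A *v z) \<bullet> (A *v z) = m * (z \<bullet> z)" if "z \<in> E" for z
    using expansion(6)[OF that] by (simp add: inner_matrix_vector_transpose)
  \<comment> \<open>Adding |A x|^2 and |A y|^2 cancels the cross terms, so m = a^2 + b^2 without x
    and y being known to be orthogonal.\<close>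
  have "m * (x \<bullet> x + y \<bullet> y) = (a\<^sup>2 + b\<^sup>2) * (x \<bullet> x + y \<bullet> y)"
    using nrm[OF xy(1)] nrm[OF xy(3)]
    by (simp add: Ax Ay inner_simps inner_commute[of y x] power2_eq_square algebra_simps)
  moreover have "x \<bullet> x + y \<bullet> y > 0" using xy by (simp add: add_pos_nonneg)
  ultimately have "a\<^sup>2 + b\<^sup>2 \<ge> 1" using expansion(3) by simp
  then have "\<not> cmod (Complex a b) < 1" by (simp add: cmod_def)
  moreover have "Complex a b \<noteq> 1"
  proof
    assume "Complex a b = 1"
    then have "A *v x = x" using Ax by (simp add: complex_eq_iff)
    then show False using expansion(7) xy by blast
  qed
  ultimately show ?thesis using spec[OF ceigenvalue_of_rotation[OF xy(2) Ax Ay]] by simp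
qed

section \<open>Convergence of the powers\<close>

lemma matrix_pow_commute: "matrix_pow A k ** A = A ** matrix_pow A k"
  by (induction k) (simp_all flip: matrix_mul_assoc)

lemma tendsto_matrix_vector_mult:
  fixes M :: "nat \<Rightarrow> real^'n^'m"
  assumes "M \<longlonglongrightarrow> L"
  shows "(\<lambda>k. M k *v x) \<longlonglongrightarrow> L *v x"
  unfolding matrix_vector_mult_def
  by (intro vec_tendstoI) (auto intro!: tendsto_intros assms)

lemma normal_matrix_convergent_imp_BAM:
  fixes A :: "real^'n^'n"
  assumes A: "normal_matrix A" and conv: "convergent (matrix_pow A)"
  shows "is_BAM ((*v) A)"
  using A
proof (cases rule: normal_matrix_contraction_cases)
  case (contraction \<gamma>)
  then show ?thesis using normal_matrix_contraction_imp_BAM[OF A] by blast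
next
  case (expansion E m)
  obtain x where x: "x \<in> E" "x \<noteq> 0"
    using expansion(1,2) subspace_0 by blast
  \<comment> \<open>A^k d is the difference of consecutive terms of A^k x, so it tends to 0 if the
    powers converge; but A does not shrink norms on E, which forces d = 0.\<close>
  define d where "d = A *v x - x"
  have d: "d \<in> E" using x expansion by (simp add: d_def subspace_diff)
  have nrm: "norm z \<le> norm (A *v z)" if "z \<in> E" for z
  proof -
    have "(A *v z) \<bullet> (A *v z) = m * (z \<bullet> z)"
      using expansion(6)[OF that] by (simp add: inner_matrix_vector_transpose)
    then show ?thesis
      using mult_right_mono[OF expansion(3), of "z \<bullet> z"] by (simp add: norm_le)
  qed
  have pow: "matrix_pow A k *v d \<in> E \<and> norm d \<le> norm (matrix_pow A k *v d)" for k
  proof (induction k)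
    case 0
    then show ?case using d by simp
  next
    case (Suc k)
    then show ?case using expansion(4) nrm
      by (auto simp flip: matrix_vector_mul_assoc intro: order_trans)
  qed
  obtain L where L: "matrix_pow A \<longlonglongrightarrow> L" using conv by (auto simp: convergent_def)
  have "matrix_pow A k *v d = matrix_pow A (Suc k) *v x - matrix_pow A k *v x" for k
    by (simp add: d_def matrix_vector_mult_diff_distrib matrix_vector_mul_assoc matrix_pow_commute)
  moreover have "(\<lambda>k. matrix_pow A (Suc k) *v x - matrix_pow A k *v x) \<longlonglongrightarrow> L *v x - L *v x"
    by (intro tendsto_diff tendsto_matrix_vector_mult L LIMSEQ_Suc)
  ultimately have "(\<lambda>k. matrix_pow A k *v d) \<longlonglongrightarrow> 0" by simp
  then have "(\<lambda>k. norm (matrix_pow A k *v d)) \<longlonglongrightarrow> 0" by (rule tendsto_norm_zero)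
  then have "norm d \<le> 0"
    by (rule LIMSEQ_le_const) (use pow in blast)
  then have "A *v x = x" by (simp add: d_def)
  then show ?thesis using expansion(7) x by blast
qed

text \<open>All iterates of x have the same projection P x, so each application of A shrinks the
  distance to P x by the factor \<gamma>.\<close>

lemma BAM_imp_matrix_pow_tendsto_proj:
  fixes A :: "real^'n^'n"
  assumes "is_BAM ((*v) A)"
  shows "\<exists>L. matrix_pow A \<longlonglongrightarrow> L \<and> (*v) L = metric_proj (Fix ((*v) A))"
proof -
  let ?P = "metric_proj (Fix ((*v) A))"
  obtain \<gamma> where \<gamma>: "0 \<le> \<gamma>" "\<gamma> < 1" and P: "\<And>x. ?P (A *v x) = ?P x"
    and contr: "\<And>x. norm (A *v x - ?P x) \<le> \<gamma> * norm (x - ?P x)"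
    using assms by (auto simp: is_BAM_def is_BAM_with_def fun_eq_iff)
  have step: "?P (matrix_pow A k *v x) = ?P x \<and>
      norm (matrix_pow A k *v x - ?P x) \<le> \<gamma> ^ k * norm (x - ?P x)" for k x
  proof (induction k)
    case 0
    then show ?case by simp
  next
    case (Suc k)
    let ?y = "matrix_pow A k *v x"
    have "norm (A *v ?y - ?P x) \<le> \<gamma> * norm (?y - ?P x)" using contr[of ?y] Suc by simp
    also have "\<dots> \<le> \<gamma> * (\<gamma> ^ k * norm (x - ?P x))"
      using Suc \<gamma> by (intro mult_left_mono) auto
    finally show ?case using Suc P[of ?y] by (simp add: mult.assoc flip: matrix_vector_mul_assoc)
  qed
  have lim: "(\<lambda>k. matrix_pow A k *v x) \<longlonglongrightarrow> ?P x" for x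
  proof (rule LIM_zero_cancel, rule Lim_null_comparison)
    show "(\<lambda>k. \<gamma> ^ k * norm (x - ?P x)) \<longlonglongrightarrow> 0"
      using \<gamma> by (intro tendsto_mult_left_zero LIMSEQ_power_zero) auto
  qed (use step in auto)
  \<comment> \<open>The columns of L are the limits of A^k on the basis vectors. Linearity of P is
    not presupposed: L x = P x follows from uniqueness of limits.\<close>
  define L :: "real^'n^'n" where "L = (\<chi> i j. ?P (axis j 1) $ i)"
  have "matrix_pow A \<longlonglongrightarrow> L"
  proof (intro vec_tendstoI)
    fix i j
    have "(\<lambda>k. (matrix_pow A k *v axis j 1) $ i) \<longlonglongrightarrow> ?P (axis j 1) $ i"
      by (intro tendsto_vec_nth lim)
    then show "(\<lambda>k. matrix_pow A k $ i $ j) \<longlonglongrightarrow> L $ i $ j"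
      by (simp add: L_def matrix_vector_mult_basis column_def)
  qed
  moreover from this have "L *v x = ?P x" for x
    using LIMSEQ_unique[OF tendsto_matrix_vector_mult lim] by blast
  ultimately show ?thesis by (auto simp: fun_eq_iff)
qed

theorem proposition3p9:
  fixes A :: "real^'n^'n"
  assumes "normal_matrix A"
  shows "(matrix_spectral_radius A < 1 \<or>
          (matrix_spectral_radius A = 1 \<and>
           {\<mu>. ceigenvalue A \<mu> \<and> cmod \<mu> = 1} = {1} \<and>
           semisimple_eigenvalue A 1)
          \<longrightarrow> is_BAM ((*v) A))
       \<and> (convergent (matrix_pow A) \<longleftrightarrow>
          (\<exists>L. matrix_pow A \<longlonglongrightarrow> L \<and> (*v) L = metric_proj (Fix ((*v) A))))
       \<and> ((\<exists>L. matrix_pow A \<longlonglongrightarrow> L \<and> (*v) L = metric_proj (Fix ((*v) A)))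
          \<longleftrightarrow> is_BAM ((*v) A))"
proof -
  \<comment> \<open>Eigenvalues are bounded in modulus by the spectral radius, so in both cases each
    lies in the open unit disc or equals 1.\<close>
  have "is_BAM ((*v) A)"
    if "matrix_spectral_radius A < 1 \<or>
        (matrix_spectral_radius A = 1 \<and> {\<mu>. ceigenvalue A \<mu> \<and> cmod \<mu> = 1} = {1})"
    using that ceigenvalue_le_spectral_radius[of A]
    by (intro normal_matrix_spectrum_imp_BAM assms) force
  \<comment> \<open>The equivalences form a cycle: convergence gives a BAM, a BAM gives the
    projection as limit, and that is convergence.\<close>
  then show ?thesis
    using normal_matrix_convergent_imp_BAM[OF assms] BAM_imp_matrix_pow_tendsto_proj[of A]
    unfolding convergent_def by blast
qed

end
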